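(* Let $u$ be a primitive word of length $n$, and let $f,g\colon[1,m]\to[1,n]$ be walks. Then $u^f=u^g$ if and only if $\langle f(i),g(i)\rangle\in\Delta^*(u)$ for all $i\in[1,m]$.
   Context: Words are over a fixed alphabet. For integers $i,k$, $[i,k]=\{j\in\mathbb{Z} : i\le j\le k\}$. For a word $u=a_1\cdots a_n$, $u[i]=a_i$ and $u[i,j]=a_i\cdots a_j$; for $f\colon[1,m]\to[1,n]$, $u^f=a_{f(1)}\cdots a_{f(m)}$. A walk is a surjection $f\colon[1,m]\to[1,n]$ with $|f(i+1)-f(i)|\le 1$ for $1\le i<m$. A word $u$ generates $w$ if $w=u^f$ for some walk $f$; $u$ is primitive if it is not generated by any strictly shorter word. A non-trivial palindrome is a word of length at least $2$ equal to its reversal. A defect of $u$ is an ordered pair $\langle i,j\rangle$ such that $u[i,j]$ is a non-trivial palindrome; $\Delta(u)$ is the set of defects of $u$, regarded as a binary relation on $[1,n]$, and $\Delta^*(u)$ is its equivalence closure (the smallest reflexive, symmetric and transitive relation on $[1,n]$ containing $\Delta(u)$). *)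

theory Defs
  imports Main
begin

text \<open>
  Words are lists over an arbitrary type of letters, and positions are natural numbers counted
  from 1. A map from \<open>[1,m]\<close> to \<open>[1,n]\<close> is a function on \<open>nat\<close> of which only the
  values on \<open>{1..m}\<close> are ever used.
\<close>

definition letter :: "'a list \<Rightarrow> nat \<Rightarrow> 'a" where
  "letter u i = u ! (i - 1)"

definition factor :: "'a list \<Rightarrow> nat \<Rightarrow> nat \<Rightarrow> 'a list" where
  "factor u i j = map (letter u) [i..<Suc j]"

text \<open>The word \<open>u\<^sup>f\<close>; the length \<open>m\<close> of the domain of \<open>f\<close> is passed explicitly.\<close>

definition word_along :: "'a list \<Rightarrow> nat \<Rightarrow> (nat \<Rightarrow> nat) \<Rightarrow> 'a list" where
  "word_along u m f = map (\<lambda>i. letter u (f i)) [1..<Suc m]"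

definition walk :: "nat \<Rightarrow> nat \<Rightarrow> (nat \<Rightarrow> nat) \<Rightarrow> bool" where
  "walk m n f \<longleftrightarrow>
     f ` {1..m} = {1..n} \<and>
     (\<forall>i. 1 \<le> i \<and> i < m \<longrightarrow> \<bar>int (f (i + 1)) - int (f i)\<bar> \<le> 1)"

definition generates :: "'a list \<Rightarrow> 'a list \<Rightarrow> bool" where
  "generates u w \<longleftrightarrow> (\<exists>m f. walk m (length u) f \<and> w = word_along u m f)"

definition primitive :: "'a list \<Rightarrow> bool" where
  "primitive u \<longleftrightarrow> \<not> (\<exists>v. length v < length u \<and> generates v u)"

definition nontrivial_palindrome :: "'a list \<Rightarrow> bool" where
  "nontrivial_palindrome w \<longleftrightarrow> 2 \<le> length w \<and> rev w = w"

definition defects :: "'a list \<Rightarrow> (nat \<times> nat) set" where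
  "defects u = {(i, j). 1 \<le> i \<and> i \<le> j \<and> j \<le> length u \<and> nontrivial_palindrome (factor u i j)}"

definition defect_equiv :: "'a list \<Rightarrow> (nat \<times> nat) set" where
  "defect_equiv u = \<Inter> {R. equiv {1..length u} R \<and> defects u \<subseteq> R}"

lemma defects_subset: "defects u \<subseteq> {1..length u} \<times> {1..length u}"
  by (auto simp: defects_def)

text \<open>The intersection is over a non-empty family, so it is itself the smallest such relation.\<close>

lemma equiv_defect_equiv: "equiv {1..length u} (defect_equiv u)"
proof -
  let ?A = "{1..length u}"
  let ?F = "{R. equiv ?A R \<and> defects u \<subseteq> R}"
  have full: "?A \<times> ?A \<in> ?F"
    using defects_subset[of u] by (auto simp: equiv_def refl_on_def sym_def trans_def)
  show ?thesis
    unfolding defect_equiv_def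
  proof (rule equivI)
    show "\<Inter> ?F \<subseteq> ?A \<times> ?A" using full by blast
    show "refl_on ?A (\<Inter> ?F)" by (auto simp: equiv_def refl_on_def)
    show "sym (\<Inter> ?F)" by (auto simp: equiv_def sym_def)
    show "trans (\<Inter> ?F)" unfolding equiv_def trans_def by blast
  qed
qed

lemma defects_subset_defect_equiv: "defects u \<subseteq> defect_equiv u"
  by (auto simp: defect_equiv_def)

end

theory Submission
  imports Defs
begin

text \<open>
  The proof is by induction on the length \<open>m\<close> of the common word \<open>w = u\<^sup>f = u\<^sup>g\<close>. A repeated letter
  of \<open>w\<close> can be deleted. Otherwise take the least \<open>L\<close> for which \<open>w\<close> has a fold of radius \<open>L\<close>: a
  palindrome \<open>x\<^sup>R x\<close> (sharing the middle letter) as prefix or suffix, or a factor \<open>x\<^sup>R x x\<^sup>R\<close>, where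
  \<open>x\<close> has length \<open>L + 1\<close>. By minimality, every turning point of \<open>f\<close> or \<open>g\<close> is the centre of
  a palindrome of radius at least \<open>L\<close>, and inside the fold a walk can turn only at the centres. At
  a centre a walk either turns or exhibits a palindrome of \<open>u\<close>, so positions mirrored there
  are visited at equivalent places. As \<open>u\<close> is primitive it has no folds itself; this lets the fold be
  cut out of both walks without losing surjectivity. A word without folds is traversed without
  turns, and then each walk is the identity or the reversal.
\<close>

section \<open>Palindromes, folds and walks on integer positions\<close>

definition pal_at :: "(int \<Rightarrow> 'a) \<Rightarrow> int \<Rightarrow> int \<Rightarrow> bool" where
  "pal_at w p r \<longleftrightarrow> (\<forall>j\<in>{0..r}. w (p - j) = w (p + j))"

text \<open>Prefix and suffix folds have the single centre \<open>p\<close>. An inner fold has a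
  second centre \<open>p + L\<close>, so it occupies the positions from \<open>p - L\<close> to
  \<open>p + 2 * L\<close>.\<close>

definition fold_at :: "int \<Rightarrow> (int \<Rightarrow> 'a) \<Rightarrow> int \<Rightarrow> bool" where
  "fold_at m w L \<longleftrightarrow> (\<exists>p. 1 \<le> p - L \<and> p + L \<le> m \<and> pal_at w p L \<and>
     (p - L = 1 \<or> p + L = m \<or> p + 2 * L \<le> m \<and> pal_at w (p + L) L))"

text \<open>An integer copy of \<open>walk\<close>, in which reflections such as
  \<open>2 * p - i\<close> involve no truncated subtraction.\<close>

definition int_walk :: "int \<Rightarrow> int \<Rightarrow> (int \<Rightarrow> int) \<Rightarrow> bool" where
  "int_walk m n f \<longleftrightarrow> f ` {1..m} = {1..n} \<and> (\<forall>i. 1 \<le> i \<and> i < m \<longrightarrow> \<bar>f (i + 1) - f i\<bar> \<le> 1)"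

definition unit_steps :: "int \<Rightarrow> (int \<Rightarrow> int) \<Rightarrow> bool" where
  "unit_steps m f \<longleftrightarrow> (\<forall>i. 1 \<le> i \<and> i < m \<longrightarrow> \<bar>f (i + 1) - f i\<bar> = 1)"

definition turn :: "int \<Rightarrow> (int \<Rightarrow> int) \<Rightarrow> int \<Rightarrow> bool" where
  "turn m f i \<longleftrightarrow> 1 < i \<and> i < m \<and> f (i - 1) = f (i + 1)"

lemma pal_atD: "pal_at w p r \<Longrightarrow> 0 \<le> j \<Longrightarrow> j \<le> r \<Longrightarrow> w (p - j) = w (p + j)"
  by (simp add: pal_at_def)

lemma pal_at_mono: "pal_at w p r \<Longrightarrow> r' \<le> r \<Longrightarrow> pal_at w p r'"
  by (simp add: pal_at_def)

lemma pal_at_reflect: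
  assumes "pal_at w p r" "\<bar>i - p\<bar> \<le> r"
  shows "w (2 * p - i) = w i"
proof (cases "i \<le> p")
  case True
  then show ?thesis using pal_atD[OF assms(1), of "p - i"] assms(2) by (simp add: algebra_simps)
next
  case False
  then show ?thesis using pal_atD[OF assms(1), of "i - p"] assms(2) by (simp add: algebra_simps)
qed

lemma int_walk_range: "int_walk m n f \<Longrightarrow> 1 \<le> i \<Longrightarrow> i \<le> m \<Longrightarrow> 1 \<le> f i \<and> f i \<le> n"
  unfolding int_walk_def by (metis atLeastAtMost_iff imageI)

section \<open>Discrete continuity and shortening of walks\<close>

lemma int_intermediate_value:
  fixes f :: "int \<Rightarrow> int"
  assumes steps: "\<forall>i. a \<le> i \<and> i < b \<longrightarrow> \<bar>f (i + 1) - f i\<bar> \<le> 1"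
    and "a \<le> b" "min (f a) (f b) \<le> v" "v \<le> max (f a) (f b)"
  shows "\<exists>i. a \<le> i \<and> i \<le> b \<and> f i = v"
  using assms(2) assms
proof (induction b rule: int_ge_induct)
  case base
  then show ?case by (intro exI[of _ a]) auto
next
  case (step b)
  show ?case
  proof (cases "v = f (b + 1)")
    case True
    then show ?thesis using step.hyps by (intro exI[of _ "b + 1"]) auto
  next
    case False
    have st: "\<bar>f (b + 1) - f b\<bar> \<le> 1" using step.prems(1) step.hyps by simp
    have "min (f a) (f b) \<le> v" "v \<le> max (f a) (f b)"
      using False st step.prems(3,4) by (auto simp: min_def max_def split: if_splits)
    then obtain i where "a \<le> i" "i \<le> b" "f i = v"
      using step.IH step.prems(1) step.hyps by auto
    then show ?thesis by (intro exI[of _ i]) auto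
  qed
qed

text \<open>By the intermediate value property, surjectivity only has to be checked at the two
  extreme values \<open>1\<close> and \<open>n\<close>.\<close>

lemma int_walkI:
  assumes range: "\<And>i. 1 \<le> i \<Longrightarrow> i \<le> m \<Longrightarrow> 1 \<le> f i \<and> f i \<le> n"
    and steps: "\<And>i. 1 \<le> i \<Longrightarrow> i < m \<Longrightarrow> \<bar>f (i + 1) - f i\<bar> \<le> 1"
    and "1 \<in> f ` {1..m}" "n \<in> f ` {1..m}"
  shows "int_walk m n f"
proof -
  obtain a b where ab: "1 \<le> a" "a \<le> m" "f a = 1" "1 \<le> b" "b \<le> m" "f b = n"
    using assms(3,4) by auto
  have "v \<in> f ` {1..m}" if "1 \<le> v" "v \<le> n" for v
  proof -
    have "\<exists>i. min a b \<le> i \<and> i \<le> max a b \<and> f i = v"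
      by (rule int_intermediate_value) (use ab steps that in \<open>auto simp: min_def max_def\<close>)
    then show ?thesis using ab by (auto simp: min_def max_def split: if_splits)
  qed
  then have "f ` {1..m} = {1..n}" using range by auto
  then show ?thesis using steps by (auto simp: int_walk_def)
qed

text \<open>Since the values at \<open>a\<close> and \<open>a + d\<close> agree, the loop between
  them can be deleted without creating a jump. Surjectivity survives as soon as both extreme values
  do; \<open>ends\<close> says that an extreme value met inside the loop is also met outside
  it.\<close>

lemma int_walk_cut:
  assumes walk: "int_walk m n f" and a: "1 \<le> a" "0 \<le> d" "a + d \<le> m" and eq: "f (a + d) = f a"
    and ends: "\<And>i. a < i \<Longrightarrow> i < a + d \<Longrightarrow> f i = 1 \<or> f i = n \<Longrightarrow>
      \<exists>j. 1 \<le> j \<and> j \<le> m \<and> (j \<le> a \<or> a + d \<le> j) \<and> f j = f i"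
  shows "int_walk (m - d) n (\<lambda>i. f (if i \<le> a then i else i + d))" (is "int_walk _ _ ?f'")
proof (rule int_walkI)
  show "1 \<le> ?f' i \<and> ?f' i \<le> n" if "1 \<le> i" "i \<le> m - d" for i
    using int_walk_range[OF walk] that a by auto
  have steps: "\<bar>f (i + 1) - f i\<bar> \<le> 1" if "1 \<le> i" "i < m" for i
    using walk that by (auto simp: int_walk_def)
  show "\<bar>?f' (i + 1) - ?f' i\<bar> \<le> 1" if i: "1 \<le> i" "i < m - d" for i
  proof -
    consider "i < a" | "i = a" | "a < i" by linarith
    then show ?thesis
    proof cases
      case 2
      then show ?thesis using steps[of "a + d"] i a eq by (simp add: algebra_simps)
    next
      case 3
      then show ?thesis using steps[of "i + d"] i a by (simp add: algebra_simps)
    qed (use steps i a in auto)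
  qed
  have kept: "v \<in> ?f' ` {1..m - d}" if v: "v = 1 \<or> v = n" "v \<in> {1..n}" for v
  proof -
    obtain i where i: "1 \<le> i" "i \<le> m" "f i = v"
      using walk v(2) by (metis (no_types, lifting) atLeastAtMost_iff imageE int_walk_def)
    obtain j where j: "1 \<le> j" "j \<le> m" "j \<le> a \<or> a + d \<le> j" "f j = v"
    proof (cases "i \<le> a \<or> a + d \<le> i")
      case True
      then show ?thesis using i that by blast
    next
      case False
      then show ?thesis using ends[of i] v i that by auto
    qed
    show ?thesis
    proof (cases "j \<le> a")
      case True
      then show ?thesis using j a by (intro image_eqI[of _ _ j]) auto
    next
      case False
      \<comment> \<open>The time \<open>a + d\<close> has been merged into \<open>a\<close>, where
        the value is the same by \<open>eq\<close>.\<close>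
      then have "v = ?f' (j - d)" using j eq by (cases "j = a + d") auto
      then show ?thesis using j False a by (intro image_eqI[of _ _ "j - d"]) auto
    qed
  qed
  have "1 \<le> n" using int_walk_range[OF walk, of 1] a by auto
  then show "1 \<in> ?f' ` {1..m - d}" "n \<in> ?f' ` {1..m - d}" using kept by auto
qed

section \<open>Straight stretches and turning points\<close>

lemma unit_steps_slope:
  assumes us: "unit_steps m f" and "1 \<le> a" "b \<le> m" "a \<le> j" "j < b"
    and nt: "\<And>i. a < i \<Longrightarrow> i < b \<Longrightarrow> \<not> turn m f i"
  shows "f (j + 1) - f j = f (a + 1) - f a"
  using assms(4,5)
proof (induction j rule: int_ge_induct)
  case base
  then show ?case by simp
next
  case (step j)
  have j: "a < j + 1" "j + 1 < b" using step by auto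
  have "\<bar>f (j + 1) - f j\<bar> = 1" "\<bar>f (j + 1 + 1) - f (j + 1)\<bar> = 1"
    using spec[OF us[unfolded unit_steps_def], of j]
      spec[OF us[unfolded unit_steps_def], of "j + 1"] assms(2,3) step.hyps j by simp_all
  moreover have "f j \<noteq> f (j + 1 + 1)" using nt[OF j] assms(2,3) j by (auto simp: turn_def)
  ultimately have "f (j + 1 + 1) - f (j + 1) = f (j + 1) - f j" by linarith
  then show ?case using step by simp
qed

lemma unit_steps_linear:
  assumes "unit_steps m f" "1 \<le> a" "b \<le> m" "a \<le> j" "j \<le> b"
    and "\<And>i. a < i \<Longrightarrow> i < b \<Longrightarrow> \<not> turn m f i"
  shows "f j = f a + (f (a + 1) - f a) * (j - a)"
  using assms(4,5)
proof (induction j rule: int_ge_induct)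
  case base
  then show ?case by simp
next
  case (step j)
  then show ?case using unit_steps_slope[OF assms(1-3), of j] assms(6)
    by (simp add: algebra_simps)
qed

text \<open>With \<open>p\<close> as the only possible turn, the walk is straight on both sides of
  \<open>p\<close>; the two slopes are opposite if it turns there and equal otherwise.\<close>

lemma unit_steps_around:
  assumes us: "unit_steps m f" and r: "1 \<le> r" "1 \<le> p - r" "p + r \<le> m"
    and nt: "\<And>i. p - r < i \<Longrightarrow> i < p + r \<Longrightarrow> i \<noteq> p \<Longrightarrow> \<not> turn m f i"
    and j: "0 \<le> j" "j \<le> r"
  shows "f (p + j) = f p + (f (p + 1) - f p) * j"
    and "turn m f p \<Longrightarrow> f (p - j) = f (p + j)"
    and "\<not> turn m f p \<Longrightarrow> f (p - j) = f p - (f (p + 1) - f p) * j"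
proof -
  show right: "f (p + j) = f p + (f (p + 1) - f p) * j"
    using unit_steps_linear[OF us, of p "p + r" "p + j"] nt r j by simp
  define t where "t = f (p - r + 1) - f (p - r)"
  have lin: "f i = f (p - r) + t * (i - (p - r))" if "p - r \<le> i" "i \<le> p" for i
    unfolding t_def by (rule unit_steps_linear[OF us, of _ p]) (use nt r that in auto)
  have left: "f (p - j) = f p - t * j"
    using lin[of "p - j"] lin[of p] r j by (simp add: algebra_simps)
  have t: "t = f p - f (p - 1)"
    using lin[of "p - 1"] lin[of p] r by (simp add: algebra_simps)
  have st: "\<bar>f (p + 1) - f p\<bar> = 1" "\<bar>f p - f (p - 1)\<bar> = 1"
    using us r spec[OF us[unfolded unit_steps_def], of "p - 1"] by (auto simp: unit_steps_def)
  show "f (p - j) = f (p + j)" if "turn m f p"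
  proof -
    have "t = - (f (p + 1) - f p)" using that t by (simp add: turn_def)
    then have "t * j = - ((f (p + 1) - f p) * j)" by (simp only: mult_minus_left)
    then show ?thesis using left right by linarith
  qed
  show "f (p - j) = f p - (f (p + 1) - f p) * j" if "\<not> turn m f p"
  proof -
    have "f (p - 1) \<noteq> f (p + 1)" using that r by (auto simp: turn_def)
    then have "t = f (p + 1) - f p" using t st by linarith
    then show ?thesis using left by simp
  qed
qed

text \<open>The symmetry of \<open>f\<close> itself, not only of the spelled word, grows around a
  turn one position at a time. It could be stopped only by another turn nearby or by an end of the
  word, and each of these would give a fold of radius less than \<open>L\<close>.\<close>

lemma turn_radius:
  assumes us: "unit_steps m f"
    and nofold: "\<And>k. 1 \<le> k \<Longrightarrow> k < L \<Longrightarrow> \<not> fold_at m (\<lambda>i. U (f i)) k"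
    and "1 \<le> k" "k \<le> L" "turn m f i"
  shows "1 \<le> i - k \<and> i + k \<le> m \<and> (\<forall>j\<in>{0..k}. f (i - j) = f (i + j))"
  using assms(3-5)
proof (induction k arbitrary: i rule: int_ge_induct)
  case base
  have "f (i - j) = f (i + j)" if "j \<in> {0..1}" for j
  proof -
    have "j = 0 \<or> j = 1" using that by auto
    then show ?thesis using base by (auto simp: turn_def)
  qed
  then show ?case using base by (auto simp: turn_def)
next
  case (step k)
  let ?w = "\<lambda>i. U (f i)"
  have IH: "1 \<le> i - k" "i + k \<le> m" "\<forall>j\<in>{0..k}. f (i - j) = f (i + j)" if "turn m f i" for i
    using step.IH[OF _ that] step.prems by auto
  have pal: "pal_at ?w i j" if "turn m f i" "j \<le> k" for i j
    using IH(3)[OF that(1)] that(2) by (auto simp: pal_at_def)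
  \<comment> \<open>Two turns at distance \<open>j\<close> are the two centres of an inner fold of
    radius \<open>j\<close>.\<close>
  have apart: "\<not> turn m f (i + j)" if "turn m f i" "1 \<le> j" "j \<le> k" for i j
  proof
    assume "turn m f (i + j)"
    then have "fold_at m ?w j"
      unfolding fold_at_def using that pal IH(1)[of i] IH(2)[of "i + j"]
      by (intro exI[of _ i]) auto
    then show False using nofold that step.prems by auto
  qed
  have nt: "\<not> turn m f j" if "i - (k + 1) < j" "j < i + (k + 1)" "j \<noteq> i" for j
    using apart[of i "j - i"] apart[of j "i - j"] that step.prems by (cases "j < i") auto
  \<comment> \<open>A symmetric range touching an end of the word would be a prefix or suffix fold
    of radius \<open>k < L\<close>; hence there is room for radius \<open>k + 1\<close>.\<close>
  have "\<not> fold_at m ?w k" using nofold step by auto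
  then have ends: "i - k \<noteq> 1" "i + k \<noteq> m"
    unfolding fold_at_def using IH[of i] pal[of i k] step.prems by auto
  have b: "1 \<le> i - (k + 1)" "i + (k + 1) \<le> m" "1 \<le> k + 1"
    using ends IH(1,2)[OF step.prems(2)] step.hyps by linarith+
  have "f (i - j) = f (i + j)" if "j \<in> {0..k+1}" for j
    by (rule unit_steps_around(2)[OF us b(3,1,2)]) (use nt that step.prems in auto)
  then show ?case using b by auto
qed

section \<open>Walks through a fold of minimal radius\<close>

text \<open>The consequences of primitivity that drive the proof are that neighbouring letters
  differ and that there are no folds. \<open>E\<close> stands for any equivalence joining the two
  ends of every palindromic factor; it is later the closure of the defects.\<close>

locale irreducible_word =
  fixes U :: "int \<Rightarrow> 'a" and n :: int and E :: "int \<Rightarrow> int \<Rightarrow> bool"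
  assumes no_repeat: "1 \<le> i \<Longrightarrow> i < n \<Longrightarrow> U i \<noteq> U (i + 1)"
    and no_fold: "1 \<le> L \<Longrightarrow> \<not> fold_at n U L"
    and E_refl: "E a a"
    and E_sym: "E a b \<Longrightarrow> E b a"
    and E_trans: "E a b \<Longrightarrow> E b c \<Longrightarrow> E a c"
    and E_pal: "1 \<le> a \<Longrightarrow> a < b \<Longrightarrow> b \<le> n \<Longrightarrow> (\<forall>j\<in>{a..b}. U (a + b - j) = U j) \<Longrightarrow> E a b"

text \<open>Set up for a single walk, to be interpreted for \<open>f\<close> and for
  \<open>g\<close>: both spell the same word and therefore share \<open>L\<close> and the
  centres.\<close>

locale minimal_fold = irreducible_word +
  fixes m :: int and L :: int and f :: "int \<Rightarrow> int"
  assumes walk: "int_walk m n f" and us: "unit_steps m f" and L: "1 \<le> L"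
    and minimal: "\<And>k. 1 \<le> k \<Longrightarrow> k < L \<Longrightarrow> \<not> fold_at m (\<lambda>i. U (f i)) k"
begin

definition centre :: "int \<Rightarrow> bool" where
  "centre p \<longleftrightarrow> 1 \<le> p - L \<and> p + L \<le> m \<and> pal_at (\<lambda>i. U (f i)) p L"

text \<open>By \<open>turn_radius\<close> a turn is itself the centre of a palindrome of radius
  \<open>L\<close>. At a distance below \<open>L\<close> from \<open>p\<close>, the two would be the
  centres of an inner fold smaller than the minimal radius.\<close>

lemma no_turn_near_centre:
  assumes "centre p" "p - L < i" "i < p + L" "i \<noteq> p"
  shows "\<not> turn m f i"
proof
  assume t: "turn m f i"
  let ?w = "\<lambda>i. U (f i)"
  note R = turn_radius[where U = U, OF us minimal L order_refl t]
  have pi: "pal_at ?w i L" using R by (auto simp: pal_at_def)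
  have pp: "pal_at ?w p L" "1 \<le> p - L" "p + L \<le> m" using assms by (auto simp: centre_def)
  have "fold_at m ?w \<bar>i - p\<bar>"
    unfolding fold_at_def
    by (rule exI[of _ "min i p"]) (use assms R pp pi pal_at_mono[OF pi] pal_at_mono[OF pp(1)] in
        \<open>auto simp: min_def abs_if\<close>)
  then show False using minimal[of "\<bar>i - p\<bar>"] assms by auto
qed

lemma unit_slope: "1 \<le> i \<Longrightarrow> i < m \<Longrightarrow> f (i + 1) - f i = 1 \<or> f (i + 1) - f i = - 1"
  using us unfolding unit_steps_def by (smt (verit))

lemma centre_around:
  assumes "centre p" "0 \<le> j" "j \<le> L"
  shows "f (p + j) = f p + (f (p + 1) - f p) * j"
    and "turn m f p \<Longrightarrow> f (p - j) = f (p + j)"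
    and "\<not> turn m f p \<Longrightarrow> f (p - j) = f p - (f (p + 1) - f p) * j"
  using unit_steps_around[OF us L, of p j] no_turn_near_centre[OF assms(1)] assms
  unfolding centre_def by auto

text \<open>On a straight passage the walk copies a factor of \<open>U\<close>, forwards or
  backwards, so the palindrome around \<open>p\<close> is present in \<open>U\<close> around
  \<open>f p\<close>.\<close>

lemma straight_centre:
  assumes "centre p" "\<not> turn m f p"
  shows "1 \<le> f p - L" "f p + L \<le> n" "pal_at U (f p) L"
proof -
  have p: "1 \<le> p - L" "p + L \<le> m" "pal_at (\<lambda>i. U (f i)) p L"
    using assms by (auto simp: centre_def)
  note A = centre_around(1)[OF assms(1)] centre_around(3)[OF assms(1) _ _ assms(2)]
  have s: "f (p + 1) - f p = 1 \<or> f (p + 1) - f p = - 1" using unit_slope[of p] p L by auto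
  have "1 \<le> f (p - L)" "f (p - L) \<le> n" "1 \<le> f (p + L)" "f (p + L) \<le> n"
    using int_walk_range[OF walk] p L by auto
  then show "1 \<le> f p - L" "f p + L \<le> n" using A[of L] s L by auto
  show "pal_at U (f p) L"
    unfolding pal_at_def
  proof
    fix j assume "j \<in> {0..L}"
    then show "U (f p - j) = U (f p + j)" using A[of j] s pal_atD[OF p(3), of j] by auto
  qed
qed

text \<open>Otherwise the palindrome of \<open>U\<close> around \<open>f p\<close> would be a prefix
  or suffix fold of \<open>U\<close>. This is what saves the extreme values when a fold is cut out
  of a walk.\<close>

lemma straight_centre_not_end:
  assumes "centre p" "\<not> turn m f p" "f i = 1 \<or> f i = n"
  shows "i \<noteq> p - L" "i \<noteq> p + L"
proof -
  note S = straight_centre[OF assms(1,2)]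
  have "f p - L \<noteq> 1" "f p + L \<noteq> n" using no_fold[OF L] S unfolding fold_at_def by auto
  moreover have "f (p + 1) - f p = 1 \<or> f (p + 1) - f p = - 1"
    using unit_slope[of p] assms(1) L by (auto simp: centre_def)
  ultimately show "i \<noteq> p - L" "i \<noteq> p + L"
    using assms(3) S centre_around(1)[OF assms(1), of L] centre_around(3)[OF assms(1), of L] assms(2) L
    by auto
qed

text \<open>If the walk turns at \<open>p\<close>, the two places coincide; if it passes straight
  through, they are the ends of a palindrome of \<open>U\<close>.\<close>

lemma centre_E:
  assumes "centre p" "\<bar>i - p\<bar> \<le> L"
  shows "E (f i) (f (2 * p - i))"
proof -
  have main: "E (f (p - j)) (f (p + j))" if j: "0 \<le> j" "j \<le> L" for j
  proof (cases "turn m f p \<or> j = 0")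
    case True
    then show ?thesis using centre_around(2)[OF assms(1) j] E_refl by auto
  next
    case False
    then have nt: "\<not> turn m f p" "0 < j" using j by auto
    note S = straight_centre[OF assms(1) nt(1)]
    have "E (f p - j) (f p + j)"
    proof (rule E_pal)
      show "\<forall>i\<in>{f p - j..f p + j}. U (f p - j + (f p + j) - i) = U i"
        using pal_at_reflect[OF S(3)] j by auto
    qed (use S nt j in auto)
    moreover have "f (p + 1) - f p = 1 \<or> f (p + 1) - f p = - 1"
      using unit_slope[of p] assms(1) L by (auto simp: centre_def)
    ultimately show ?thesis
      using centre_around(1)[OF assms(1) j] centre_around(3)[OF assms(1) j nt(1)] E_sym by auto
  qed
  show ?thesis
  proof (cases "i \<le> p")
    case True
    then show ?thesis using main[of "p - i"] assms(2) by (simp add: algebra_simps)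
  next
    case False
    then show ?thesis using E_sym[OF main[of "i - p"]] assms(2) by (simp add: algebra_simps)
  qed
qed

text \<open>An end of the word has one neighbour only, so the walk must leave to the place it came
  from.\<close>

lemma end_is_turn:
  assumes "1 < i" "i < m" "f i = 1 \<or> f i = n"
  shows "turn m f i"
proof -
  have "\<bar>f (i + 1) - f i\<bar> = 1" "\<bar>f i - f (i - 1)\<bar> = 1"
    using us assms spec[OF us[unfolded unit_steps_def], of "i - 1"] by (auto simp: unit_steps_def)
  moreover have "1 \<le> f (i - 1)" "f (i - 1) \<le> n" "1 \<le> f (i + 1)" "f (i + 1) \<le> n"
    using int_walk_range[OF walk] assms by auto
  ultimately show ?thesis using assms by (auto simp: turn_def)
qed

text \<open>Which \<open>2 * L\<close> times are cut depends on where the walk turns. The conclusion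
  nevertheless always compares \<open>f'\<close> with \<open>f\<close> after deletion of the times
  from \<open>p + 1\<close> to \<open>p + 2 * L\<close>, so two walks that were cut differently can
  still be compared index by index.\<close>

lemma reduce_inner:
  assumes c: "centre p" "centre (p + L)"
  obtains f' where "int_walk (m - 2 * L) n f'"
    "\<And>i. 1 \<le> i \<Longrightarrow> i \<le> p \<Longrightarrow> E (f i) (f' i) \<and> U (f' i) = U (f i)"
    "\<And>i. p < i \<Longrightarrow> i \<le> m - 2 * L \<Longrightarrow> E (f (i + 2 * L)) (f' i) \<and> U (f' i) = U (f (i + 2 * L))"
proof -
  let ?w = "\<lambda>i. U (f i)"
  have p: "1 \<le> p - L" "p + 2 * L \<le> m" "pal_at ?w p L" "pal_at ?w (p + L) L"
    using c by (auto simp: centre_def)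
  have turns: "i = p \<or> i = p + L" if "turn m f i" "p - L < i" "i < p + 2 * L" for i
    using no_turn_near_centre[OF c(1), of i] no_turn_near_centre[OF c(2), of i] that by fastforce
  show ?thesis
  proof (cases "turn m f (p + L)")
    case True
    \<comment> \<open>Having turned at \<open>p + L\<close>, the walk is back at \<open>f p\<close>
      at time \<open>p + 2 * L\<close>; the loop starting at \<open>p\<close> is cut.\<close>
    have eq: "f (p + 2 * L) = f p"
      using centre_around(2)[OF c(2) _ _ True, of L] L by (simp add: algebra_simps)
    have "int_walk (m - 2 * L) n (\<lambda>i. f (if i \<le> p then i else i + 2 * L))"
    proof (rule int_walk_cut[OF walk])
      fix i assume i: "p < i" "i < p + 2 * L" "f i = 1 \<or> f i = n"
      \<comment> \<open>An end of \<open>U\<close> inside the loop is met at a turn, hence at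
        \<open>p + L\<close>. A straight passage through \<open>p\<close> would exclude this, so the
        walk also turns at \<open>p\<close> and has met the same end at
        \<open>p - L\<close>.\<close>
      have "turn m f i" using end_is_turn[of i] i p L by auto
      then have iq: "i = p + L" using turns[of i] i L by auto
      then have "turn m f p" using straight_centre_not_end(2)[OF c(1) _ i(3)] by auto
      then have "f (p - L) = f i" using centre_around(2)[OF c(1), of L] iq L by auto
      then show "\<exists>j. 1 \<le> j \<and> j \<le> m \<and> (j \<le> p \<or> p + 2 * L \<le> j) \<and> f j = f i"
        using p L by (intro exI[of _ "p - L"]) auto
    qed (use p L eq in auto)
    then show ?thesis by (rule that) (auto simp: E_refl)
  next
    case False
    \<comment> \<open>Straight passages through both centres would exhibit an inner fold in
      \<open>U\<close>; its left centre is the smaller of the two values, as the walk may be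
      descending.\<close>
    have tp: "turn m f p"
    proof (rule ccontr)
      assume nt: "\<not> turn m f p"
      note S = straight_centre[OF c(1) nt] straight_centre[OF c(2) False]
      have "f (p + L) = f p + L \<or> f (p + L) = f p - L"
        using centre_around(1)[OF c(1), of L] unit_slope[of p] p L by auto
      then have "fold_at n U L"
        unfolding fold_at_def
        by (intro exI[of _ "min (f p) (f (p + L))"]) (use S L in \<open>auto simp: min_def\<close>)
      then show False using no_fold L by auto
    qed
    have eq: "f (p - L + 2 * L) = f (p - L)"
      using centre_around(2)[OF c(1) _ _ tp, of L] L by (simp add: algebra_simps)
    \<comment> \<open>Here the loop around \<open>p\<close>, from \<open>p - L\<close> to
      \<open>p + L\<close>, is cut instead.\<close>
    let ?f' = "\<lambda>i. f (if i \<le> p - L then i else i + 2 * L)"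
    have "int_walk (m - 2 * L) n ?f'"
    proof (rule int_walk_cut[OF walk])
      fix i assume i: "p - L < i" "i < p - L + 2 * L" "f i = 1 \<or> f i = n"
      \<comment> \<open>Inside this loop an end of \<open>U\<close> could be met only at
        \<open>p\<close>, which is the left border of the range mirrored at the straight centre
        \<open>p + L\<close>.\<close>
      have "turn m f i" using end_is_turn[of i] i p L by auto
      then have "i = p" using turns[of i] i L by auto
      then show "\<exists>j. 1 \<le> j \<and> j \<le> m \<and> (j \<le> p - L \<or> p - L + 2 * L \<le> j) \<and> f j = f i"
        using straight_centre_not_end(1)[OF c(2) False i(3)] by auto
    qed (use p L eq in auto)
    moreover have "E (f i) (?f' i) \<and> U (?f' i) = U (f i)" if "1 \<le> i" "i \<le> p" for i
    proof (cases "i \<le> p - L")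
      case outside: False
      \<comment> \<open>Reflecting at \<open>p\<close> and then at \<open>p + L\<close> shifts time
        by \<open>2 * L\<close>.\<close>
      have r: "2 * (p + L) - (2 * p - i) = i + 2 * L" by simp
      have "E (f i) (f (i + 2 * L))"
        using E_trans[OF centre_E[OF c(1), of i] centre_E[OF c(2), of "2 * p - i"]] outside that r L
        by (simp add: add.commute)
      moreover have "U (f (i + 2 * L)) = U (f i)"
        using pal_at_reflect[OF p(3), of i] pal_at_reflect[OF p(4), of "2 * p - i"] outside that r L
        by (simp add: add.commute)
      ultimately show ?thesis using outside by simp
    qed (simp add: E_refl)
    moreover have "?f' i = f (i + 2 * L)" if "p < i" for i using that L by simp
    ultimately show ?thesis by (intro that[of ?f']) (auto simp: E_refl)
  qed
qed

text \<open>Dropping the first \<open>L\<close> times loses no extreme value: among them it can be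
  met only at time \<open>1\<close>, since the others are not turns. Then the walk does not pass
  \<open>L + 1\<close> straight, so it turns there and meets the same value again at time
  \<open>2 * L + 1\<close>.\<close>

lemma reduce_prefix:
  assumes c: "centre (L + 1)"
  shows "int_walk (m - L) n (\<lambda>i. f (i + L))"
proof (rule int_walkI)
  have m: "2 * L + 1 \<le> m" using c by (simp add: centre_def)
  show "1 \<le> f (i + L) \<and> f (i + L) \<le> n" if "1 \<le> i" "i \<le> m - L" for i
    using int_walk_range[OF walk, of "i + L"] that L by auto
  show "\<bar>f (i + 1 + L) - f (i + L)\<bar> \<le> 1" if "1 \<le> i" "i < m - L" for i
    using spec[OF us[unfolded unit_steps_def], of "i + L"] that L by (simp add: algebra_simps)
  have kept: "v \<in> (\<lambda>i. f (i + L)) ` {1..m - L}" if v: "v = 1 \<or> v = n" "v \<in> {1..n}" for v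
  proof -
    obtain i where i: "1 \<le> i" "i \<le> m" "f i = v"
      using walk v(2) by (metis (no_types, lifting) atLeastAtMost_iff imageE int_walk_def)
    obtain j where j: "L < j" "j \<le> m" "f j = v"
    proof (cases "L < i")
      case True
      then show ?thesis using i that by blast
    next
      case False
      have "\<not> turn m f i" if "1 < i" using no_turn_near_centre[OF c, of i] that False by auto
      then have i1: "i = 1" using end_is_turn[of i] i v False m L by fastforce
      then have "turn m f (L + 1)" using straight_centre_not_end(1)[OF c, of i] i v by auto
      then have "f (2 * L + 1) = v"
        using centre_around(2)[OF c, of L] i i1 L by (simp add: algebra_simps)
      then show ?thesis using that[of "2 * L + 1"] m L by auto
    qed
    then show ?thesis by (intro image_eqI[of _ _ "j - L"]) auto
  qed
  have "1 \<le> n" using int_walk_range[OF walk, of 1] m L by auto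
  then show "1 \<in> (\<lambda>i. f (i + L)) ` {1..m - L}" "n \<in> (\<lambda>i. f (i + L)) ` {1..m - L}"
    using kept by auto
qed

end

section \<open>Dependence on the spelled word and reversal of time\<close>

lemma pal_at_cong:
  assumes "\<forall>i\<in>{1..m}. w i = w' i" "1 \<le> p - r" "p + r \<le> m"
  shows "pal_at w p r \<longleftrightarrow> pal_at w' p r"
  using assms by (auto simp: pal_at_def)

lemma fold_at_cong:
  assumes "\<forall>i\<in>{1..m}. w i = w' i" "0 \<le> k"
  shows "fold_at m w k \<longleftrightarrow> fold_at m w' k"
proof -
  have "pal_at w p k \<longleftrightarrow> pal_at w' p k" if "1 \<le> p - k" "p + k \<le> m" for p
    using pal_at_cong[OF assms(1) that] .
  moreover have "pal_at w (p + k) k \<longleftrightarrow> pal_at w' (p + k) k" if "1 \<le> p - k" "p + 2 * k \<le> m" for p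
    using pal_at_cong[OF assms(1), of "p + k" k] that assms(2) by simp
  ultimately show ?thesis unfolding fold_at_def by blast
qed

lemma pal_at_reverse: "pal_at (\<lambda>i. w (c - i)) p r \<longleftrightarrow> pal_at w (c - p) r"
proof -
  have "c - (p - j) = c - p + j" "c - (p + j) = c - p - j" for j :: int by auto
  then show ?thesis unfolding pal_at_def by (metis (lifting))
qed

lemma fold_at_reverse:
  assumes "fold_at m (\<lambda>i. w (m + 1 - i)) L" "0 \<le> L"
  shows "fold_at m w L"
proof -
  obtain p where p: "1 \<le> p - L" "p + L \<le> m" "pal_at w (m + 1 - p) L"
    "p - L = 1 \<or> p + L = m \<or> p + 2 * L \<le> m \<and> pal_at w (m + 1 - (p + L)) L"
    using assms(1) unfolding fold_at_def pal_at_reverse by blast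
  show ?thesis
  proof (cases "p - L = 1 \<or> p + L = m")
    case True
    then show ?thesis unfolding fold_at_def
      by (intro exI[of _ "m + 1 - p"]) (use p in auto)
  next
    case False
    \<comment> \<open>Reversal exchanges the order of the two centres, so the image of
      \<open>p + L\<close> comes first.\<close>
    then show ?thesis unfolding fold_at_def
      by (intro exI[of _ "m + 1 - (p + L)"]) (use p assms(2) in \<open>auto simp: algebra_simps\<close>)
  qed
qed

lemma int_walk_reverse:
  assumes "int_walk m n f"
  shows "int_walk m n (\<lambda>i. f (m + 1 - i))"
proof -
  have "(\<lambda>i. f (m + 1 - i)) ` {1..m} = f ` {1..m}"
  proof (intro equalityI subsetI)
    fix v assume "v \<in> f ` {1..m}"
    then obtain i where "i \<in> {1..m}" "v = f i" by blast
    then show "v \<in> (\<lambda>i. f (m + 1 - i)) ` {1..m}" by (intro image_eqI[of _ _ "m + 1 - i"]) auto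
  qed auto
  moreover have "\<bar>f (m + 1 - (i + 1)) - f (m + 1 - i)\<bar> \<le> 1" if "1 \<le> i" "i < m" for i
  proof -
    have "\<bar>f (m - i + 1) - f (m - i)\<bar> \<le> 1" using assms that by (simp add: int_walk_def)
    then show ?thesis by (simp add: algebra_simps abs_minus_commute)
  qed
  ultimately show ?thesis using assms by (simp add: int_walk_def)
qed

lemma unit_steps_reverse:
  assumes "unit_steps m f"
  shows "unit_steps m (\<lambda>i. f (m + 1 - i))"
  unfolding unit_steps_def
proof (intro allI impI)
  fix i assume "1 \<le> i \<and> i < m"
  then have "\<bar>f (m - i + 1) - f (m - i)\<bar> = 1" using assms by (simp add: unit_steps_def)
  then show "\<bar>f (m + 1 - (i + 1)) - f (m + 1 - i)\<bar> = 1"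
    by (simp add: algebra_simps abs_minus_commute)
qed

text \<open>Used to reduce suffix folds to prefix folds.\<close>

lemma minimal_fold_reverse:
  assumes "minimal_fold U n E m L f"
  shows "minimal_fold U n E m L (\<lambda>i. f (m + 1 - i))"
proof -
  interpret minimal_fold U n E m L f by fact
  have "\<not> fold_at m (\<lambda>i. U (f (m + 1 - i))) k" if "1 \<le> k" "k < L" for k
    using minimal[OF that] fold_at_reverse[where w = "\<lambda>i. U (f i)", of m k] that by auto
  then show ?thesis
    by unfold_locales (use int_walk_reverse[OF walk] unit_steps_reverse[OF us] L in auto)
qed

section \<open>Induction on the length of the walks\<close>

context irreducible_word
begin

text \<open>The implication from equal words to equivalent positions, for one length
  \<open>m\<close>. Quantifying over both walks makes it an induction hypothesis for shortened
  walks.\<close>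

definition walks_related :: "int \<Rightarrow> bool" where
  "walks_related m \<longleftrightarrow> (\<forall>f g. int_walk m n f \<longrightarrow> int_walk m n g \<longrightarrow>
     (\<forall>i\<in>{1..m}. U (f i) = U (g i)) \<longrightarrow> (\<forall>i\<in>{1..m}. E (f i) (g i)))"

lemma walks_relatedD:
  "walks_related m \<Longrightarrow> int_walk m n f \<Longrightarrow> int_walk m n g \<Longrightarrow>
     (\<And>i. 1 \<le> i \<Longrightarrow> i \<le> m \<Longrightarrow> U (f i) = U (g i)) \<Longrightarrow> 1 \<le> i \<Longrightarrow> i \<le> m \<Longrightarrow> E (f i) (g i)"
  unfolding walks_related_def by auto

lemma E_chain: "E a a' \<Longrightarrow> E b b' \<Longrightarrow> E a' b' \<Longrightarrow> E a b"
  using E_sym E_trans by blast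

text \<open>The induction hypothesis settles the times after \<open>L\<close>; earlier times are
  reflected at the centre \<open>L + 1\<close>, simultaneously in both walks.\<close>

lemma walks_related_prefix:
  assumes f: "minimal_fold U n E m L f" and g: "minimal_fold U n E m L g"
    and eq: "\<forall>i\<in>{1..m}. U (f i) = U (g i)"
    and m: "2 * L + 1 \<le> m" and pal: "pal_at (\<lambda>i. U (f i)) (L + 1) L"
    and IH: "walks_related (m - L)"
  shows "\<forall>i\<in>{1..m}. E (f i) (g i)"
proof
  interpret F: minimal_fold U n E m L f by fact
  interpret G: minimal_fold U n E m L g by fact
  have cf: "F.centre (L + 1)" using m pal by (simp add: F.centre_def)
  have cg: "G.centre (L + 1)"
    using m pal pal_at_cong[OF eq, of "L + 1" L] by (simp add: G.centre_def)
  have right: "E (f i) (g i)" if "L < i" "i \<le> m" for i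
    using walks_relatedD[OF IH F.reduce_prefix[OF cf] G.reduce_prefix[OF cg], of "i - L"] eq that F.L
    by auto
  fix i assume i: "i \<in> {1..m}"
  show "E (f i) (g i)"
  proof (cases "L < i")
    case False
    then show ?thesis
      using E_chain[OF F.centre_E[OF cf, of i] G.centre_E[OF cg, of i]]
        right[of "2 * (L + 1) - i"] i m by auto
  qed (use right i in auto)
qed

text \<open>After cutting both walks, the induction hypothesis covers the times up to
  \<open>p\<close> and those after \<open>p + 2 * L\<close>. The gap is filled by reflecting first
  at \<open>p\<close> and then at \<open>p + L\<close>.\<close>

lemma walks_related_inner:
  assumes f: "minimal_fold U n E m L f" and g: "minimal_fold U n E m L g"
    and eq: "\<forall>i\<in>{1..m}. U (f i) = U (g i)"
    and p: "1 \<le> p - L" "p + 2 * L \<le> m"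
    and pal: "pal_at (\<lambda>i. U (f i)) p L" "pal_at (\<lambda>i. U (f i)) (p + L) L"
    and IH: "walks_related (m - 2 * L)"
  shows "\<forall>i\<in>{1..m}. E (f i) (g i)"
proof
  interpret F: minimal_fold U n E m L f by fact
  interpret G: minimal_fold U n E m L g by fact
  have L: "1 \<le> L" by (rule F.L)
  have cf: "F.centre p" "F.centre (p + L)" using p pal L by (auto simp: F.centre_def)
  have cg: "G.centre p" "G.centre (p + L)"
    using p pal pal_at_cong[OF eq, of p L] pal_at_cong[OF eq, of "p + L" L] L
    by (auto simp: G.centre_def)
  obtain f' where f': "int_walk (m - 2 * L) n f'"
    "\<And>i. 1 \<le> i \<Longrightarrow> i \<le> p \<Longrightarrow> E (f i) (f' i) \<and> U (f' i) = U (f i)"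
    "\<And>i. p < i \<Longrightarrow> i \<le> m - 2 * L \<Longrightarrow> E (f (i + 2 * L)) (f' i) \<and> U (f' i) = U (f (i + 2 * L))"
    using F.reduce_inner[OF cf] by blast
  obtain g' where g': "int_walk (m - 2 * L) n g'"
    "\<And>i. 1 \<le> i \<Longrightarrow> i \<le> p \<Longrightarrow> E (g i) (g' i) \<and> U (g' i) = U (g i)"
    "\<And>i. p < i \<Longrightarrow> i \<le> m - 2 * L \<Longrightarrow> E (g (i + 2 * L)) (g' i) \<and> U (g' i) = U (g (i + 2 * L))"
    using G.reduce_inner[OF cg] by blast
  have "U (f' i) = U (g' i)" if "1 \<le> i" "i \<le> m - 2 * L" for i
  proof (cases "i \<le> p")
    case True
    then show ?thesis using f'(2)[of i] g'(2)[of i] eq that p L by auto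
  next
    case False
    then show ?thesis using f'(3)[of i] g'(3)[of i] eq that L by auto
  qed
  then have E': "E (f' i) (g' i)" if "1 \<le> i" "i \<le> m - 2 * L" for i
    using walks_relatedD[OF IH f'(1) g'(1)] that by blast
  have left: "E (f i) (g i)" if "1 \<le> i" "i \<le> p" for i
    using E_chain[of "f i" "f' i" "g i" "g' i"] f'(2)[of i] g'(2)[of i] E'[of i] that p by auto
  have mid: "E (f i) (g i)" if "1 \<le> i" "i \<le> p + L" for i
  proof (cases "i \<le> p")
    case False
    then show ?thesis
      using E_chain[OF F.centre_E[OF cf(1), of i] G.centre_E[OF cg(1), of i]]
        left[of "2 * p - i"] that p by auto
  qed (use left that in auto)
  fix i assume i: "i \<in> {1..m}"
  consider "i \<le> p + L" | "p + L < i" "i \<le> p + 2 * L" | "p + 2 * L < i" by linarith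
  then show "E (f i) (g i)"
  proof cases
    case 1
    then show ?thesis using mid i by auto
  next
    case 2
    then show ?thesis
      using E_chain[OF F.centre_E[OF cf(2), of i] G.centre_E[OF cg(2), of i]]
        mid[of "2 * (p + L) - i"] p L by auto
  next
    case 3
    then show ?thesis
      using E_chain[of "f i" "f' (i - 2 * L)" "g i" "g' (i - 2 * L)"]
        f'(3)[of "i - 2 * L"] g'(3)[of "i - 2 * L"] E'[of "i - 2 * L"] i p L by auto
  qed
qed

lemma walks_related_fold:
  assumes f: "minimal_fold U n E m L f" and g: "minimal_fold U n E m L g"
    and eq: "\<forall>i\<in>{1..m}. U (f i) = U (g i)"
    and fold: "fold_at m (\<lambda>i. U (f i)) L"
    and IH: "\<And>k. k < m \<Longrightarrow> walks_related k"
  shows "\<forall>i\<in>{1..m}. E (f i) (g i)"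
proof -
  have L: "1 \<le> L" using f by (simp add: minimal_fold_def minimal_fold_axioms_def)
  obtain p where p: "1 \<le> p - L" "p + L \<le> m" "pal_at (\<lambda>i. U (f i)) p L"
    and "p - L = 1 \<or> p + L = m \<or> p + 2 * L \<le> m \<and> pal_at (\<lambda>i. U (f i)) (p + L) L"
    using fold unfolding fold_at_def by blast
  then consider "p = L + 1" | "p = m - L" | "p + 2 * L \<le> m" "pal_at (\<lambda>i. U (f i)) (p + L) L"
    by fastforce
  then show ?thesis
  proof cases
    case 1
    then show ?thesis using walks_related_prefix[OF f g eq] p L IH by auto
  next
    case 2
    \<comment> \<open>A suffix fold becomes a prefix fold when both walks are run backwards.\<close>
    let ?r = "\<lambda>h i. h (m + 1 - i) :: int"
    have "pal_at (\<lambda>i. U (?r f i)) (L + 1) L"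
      using p(3) 2 pal_at_reverse[of "\<lambda>i. U (f i)" "m + 1" "L + 1" L] by simp
    then have *: "\<forall>i\<in>{1..m}. E (?r f i) (?r g i)"
      by (intro walks_related_prefix[OF minimal_fold_reverse[OF f] minimal_fold_reverse[OF g]])
        (use eq p 2 L IH in auto)
    show ?thesis
    proof
      fix i assume "i \<in> {1..m}"
      then show "E (f i) (g i)" using bspec[OF *, of "m + 1 - i"] by auto
    qed
  next
    case 3
    then show ?thesis using walks_related_inner[OF f g eq p(1) _ p(3)] L IH by auto
  qed
qed

text \<open>Without folds every turn would have radius \<open>m\<close>, which does not fit into the
  domain. So the slope is constant, and surjectivity fixes the starting point.\<close>

lemma unfolded_walk:
  assumes walk: "int_walk m n f" and us: "unit_steps m f"
    and nofold: "\<And>k. 1 \<le> k \<Longrightarrow> \<not> fold_at m (\<lambda>i. U (f i)) k"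
  shows "(\<forall>i\<in>{1..m}. f i = i) \<or> (\<forall>i\<in>{1..m}. f i = n + 1 - i)"
proof (cases "1 \<le> m")
  case True
  have nt: "\<not> turn m f i" for i
  proof
    assume t: "turn m f i"
    have "1 \<le> i - m \<and> i + m \<le> m \<and> (\<forall>j\<in>{0..m}. f (i - j) = f (i + j))"
      by (rule turn_radius[where U = U and L = m, OF us]) (use nofold True t in auto)
    then show False using t by (simp add: turn_def)
  qed
  define s where "s = f 2 - f 1"
  have lin: "f i = f 1 + s * (i - 1)" if "1 \<le> i" "i \<le> m" for i
    using unit_steps_linear[OF us, of 1 m i] nt that by (simp add: s_def)
  have n: "1 \<le> n" using int_walk_range[OF walk, of 1] True by auto
  have img: "f ` {1..m} = {1..n}" using walk by (simp add: int_walk_def)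
  have "1 \<in> f ` {1..m}" "n \<in> f ` {1..m}" using n unfolding img by auto
  then obtain a b where ab: "1 \<le> a" "a \<le> m" "f a = 1" "1 \<le> b" "b \<le> m" "f b = n"
    by auto
  have f1: "1 \<le> f 1" "f 1 \<le> n" using int_walk_range[OF walk, of 1] True by auto
  \<comment> \<open>For \<open>m = 1\<close> the value \<open>f 2\<close> lies outside the walk and
    \<open>s\<close> carries no information.\<close>
  consider "m = 1" | "s = 1" | "s = - 1"
  proof -
    have "\<bar>s\<bar> = 1" if "m \<noteq> 1"
      using spec[OF us[unfolded unit_steps_def], of 1] True that by (simp add: s_def)
    then show ?thesis using that by (cases "m = 1") (auto simp: abs_if split: if_splits)
  qed
  then show ?thesis
  proof cases
    case 1
    then have "a = 1" using ab by simp
    then have "f 1 = 1" using ab by simp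
    moreover have "i = 1" if "i \<in> {1..m}" for i using that 1 by simp
    ultimately show ?thesis by blast
  next
    case 2
    then have "f 1 = 1" using lin[OF ab(1,2)] ab f1 by simp
    then have "f i = i" if "i \<in> {1..m}" for i using lin[of i] 2 that by simp
    then show ?thesis by blast
  next
    case 3
    then have "f 1 = n" using lin[OF ab(4,5)] ab f1 by simp
    then have "f i = n + 1 - i" if "i \<in> {1..m}" for i using lin[of i] 3 that by simp
    then show ?thesis by blast
  qed
qed auto

text \<open>In a palindromic word all concentric factors are palindromes as well.\<close>

lemma E_reversal:
  assumes "\<forall>j\<in>{1..n}. U (n + 1 - j) = U j" "1 \<le> i" "i \<le> n"
  shows "E i (n + 1 - i)"
proof -
  have lt: "E a (n + 1 - a)" if "1 \<le> a" "a < n + 1 - a" for a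
    by (rule E_pal) (use assms(1) that in auto)
  consider "i < n + 1 - i" | "i = n + 1 - i" | "n + 1 - i < i" by linarith
  then show ?thesis
  proof cases
    case 1
    then show ?thesis using lt assms by blast
  next
    case 2
    then have "n + 1 - i = i" by simp
    then show ?thesis by (simp only: E_refl)
  next
    case 3
    then show ?thesis using E_sym[OF lt[of "n + 1 - i"]] assms by auto
  qed
qed

lemma all_walks_related:
  fixes m :: int
  shows "walks_related m"
proof (induction "nat m" arbitrary: m rule: less_induct)
  case less
  show ?case
  proof (cases "1 \<le> m")
    case False
    then show ?thesis by (auto simp: walks_related_def)
  next
    case m: True
    have IH: "walks_related k" if "k < m" for k using less[of k] that m by auto
    show ?thesis
      unfolding walks_related_def
    proof (intro allI impI)
      fix f g assume f: "int_walk m n f" and g: "int_walk m n g"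
        and eq: "\<forall>i\<in>{1..m}. U (f i) = U (g i)"
      \<comment> \<open>Neighbouring letters of \<open>U\<close> differ, so a walk reading the same
        letter twice in a row has not moved.\<close>
      have stay: "h (k + 1) = h k"
        if "int_walk m n h" "1 \<le> k" "k < m" "U (h k) = U (h (k + 1))" for h k
      proof (rule ccontr)
        assume "h (k + 1) \<noteq> h k"
        moreover have "\<bar>h (k + 1) - h k\<bar> \<le> 1" using that by (auto simp: int_walk_def)
        ultimately have "h (k + 1) = h k + 1 \<or> h k = h (k + 1) + 1" by linarith
        then show False
          using no_repeat[of "h k"] no_repeat[of "h (k + 1)"] that
            int_walk_range[OF that(1), of k] int_walk_range[OF that(1), of "k + 1"] by auto
      qed
      show "\<forall>i\<in>{1..m}. E (f i) (g i)"
      proof (cases "\<exists>k. 1 \<le> k \<and> k < m \<and> U (f k) = U (f (k + 1))")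
        case True
        then obtain k where k: "1 \<le> k" "k < m" "U (f k) = U (f (k + 1))" by blast
        have "U (g k) = U (g (k + 1))" using bspec[OF eq, of k] bspec[OF eq, of "k + 1"] k by simp
        then have fk: "f (k + 1) = f k" and gk: "g (k + 1) = g k"
          using stay[OF f k] stay[OF g k(1,2)] by auto
        \<comment> \<open>Both walks pause at \<open>k\<close>; dropping time \<open>k + 1\<close>
          leaves two walks with a common, shorter word.\<close>
        let ?c = "\<lambda>h i. h (if i \<le> k then i else i + 1) :: int"
        have w: "int_walk (m - 1) n (?c f)" "int_walk (m - 1) n (?c g)"
          using int_walk_cut[OF f, of k 1] int_walk_cut[OF g, of k 1] k fk gk by auto
        have E: "E (?c f i) (?c g i)" if "1 \<le> i" "i \<le> m - 1" for i
          by (rule walks_relatedD[OF IH w]) (use eq that in auto)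
        show ?thesis
        proof
          fix i assume i: "i \<in> {1..m}"
          consider "i \<le> k" | "i = k + 1" | "k + 1 < i" by linarith
          then show "E (f i) (g i)"
          proof cases
            case 1
            then show ?thesis using E[of i] i k by auto
          next
            case 2
            then show ?thesis using E[of k] fk gk k by auto
          next
            case 3
            then show ?thesis using E[of "i - 1"] i k by auto
          qed
        qed
      next
        case no: False
        have us: "unit_steps m h" if h: "int_walk m n h" and eq': "\<forall>i\<in>{1..m}. U (f i) = U (h i)" for h
          unfolding unit_steps_def
        proof (intro allI impI)
          fix i assume i: "1 \<le> i \<and> i < m"
          have "U (f i) \<noteq> U (f (i + 1))" using no i by auto
          then have "U (h i) \<noteq> U (h (i + 1))" using eq' i by auto
          then have "h i \<noteq> h (i + 1)" by auto
          moreover have "\<bar>h (i + 1) - h i\<bar> \<le> 1" using h i by (auto simp: int_walk_def)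
          ultimately show "\<bar>h (i + 1) - h i\<bar> = 1" by linarith
        qed
        have usf: "unit_steps m f" and usg: "unit_steps m g" using us f g eq by auto
        have cong: "fold_at m (\<lambda>i. U (f i)) k \<longleftrightarrow> fold_at m (\<lambda>i. U (g i)) k" if "1 \<le> k" for k
          by (rule fold_at_cong[OF eq]) (use that in auto)
        show ?thesis
        proof (cases "\<exists>k\<ge>1. fold_at m (\<lambda>i. U (f i)) k")
          case True
          \<comment> \<open>Radii are moved to the naturals, where a least one exists.\<close>
          define P where "P l \<longleftrightarrow> 1 \<le> l \<and> fold_at m (\<lambda>i. U (f i)) (int l)" for l :: nat
          obtain k where "1 \<le> k" "fold_at m (\<lambda>i. U (f i)) k" using True by blast
          then have "P (nat k)" by (auto simp: P_def)
          then obtain l where l: "P l" "\<And>l'. l' < l \<Longrightarrow> \<not> P l'"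
            using exists_least_iff[of P] by blast
          have minf: "\<not> fold_at m (\<lambda>i. U (f i)) k" if "1 \<le> k" "k < int l" for k
            using l(2)[of "nat k"] that by (auto simp: P_def)
          have "minimal_fold U n E m (int l) f"
            by unfold_locales (use f usf l minf in \<open>auto simp: P_def\<close>)
          moreover have "minimal_fold U n E m (int l) g"
            by unfold_locales (use g usg l minf cong in \<open>auto simp: P_def\<close>)
          ultimately show ?thesis
            using walks_related_fold eq l(1) IH unfolding P_def by blast
        next
          case False
          then have nf: "\<not> fold_at m (\<lambda>i. U (f i)) k" "\<not> fold_at m (\<lambda>i. U (g i)) k"
            if "1 \<le> k" for k using cong that by auto
          have cf: "(\<forall>i\<in>{1..m}. f i = i) \<or> (\<forall>i\<in>{1..m}. f i = n + 1 - i)"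
            and cg: "(\<forall>i\<in>{1..m}. g i = i) \<or> (\<forall>i\<in>{1..m}. g i = n + 1 - i)"
            using unfolded_walk[OF f usf] unfolded_walk[OF g usg] nf by blast+
          \<comment> \<open>One walk is the identity and the other the reversal: surjectivity gives
            \<open>m = n\<close>, and equality of the words makes \<open>U\<close> a
            palindrome.\<close>
          have opposite: "E i (n + 1 - i)"
            if h: "int_walk m n h" and id: "\<forall>i\<in>{1..m}. h i = i"
              and rv: "\<forall>i\<in>{1..m}. U (n + 1 - i) = U i" and i: "1 \<le> i" "i \<le> m" for h i
          proof -
            have "h ` {1..m} = {1..n}" using h by (simp add: int_walk_def)
            moreover have "h ` {1..m} = {1..m}" using id by simp
            ultimately have "{1..m} = {1..n}" by simp
            then show ?thesis using E_reversal[of i] rv i by auto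
          qed
          from cf cg show ?thesis
          proof (elim disjE)
            assume *: "\<forall>i\<in>{1..m}. f i = i" "\<forall>i\<in>{1..m}. g i = n + 1 - i"
            then show ?thesis using opposite[OF f *(1)] eq by simp
          next
            assume *: "\<forall>i\<in>{1..m}. f i = n + 1 - i" "\<forall>i\<in>{1..m}. g i = i"
            then show ?thesis using opposite[OF g *(2)] eq E_sym by simp
          qed (auto simp: E_refl)
        qed
      qed
    qed
  qed
qed

end

section \<open>Primitive words have no repeated letters and no folds\<close>

text \<open>The shorter generator is described by a letter function \<open>v\<close> on integers;
  the proof turns its values on \<open>[1,k]\<close> into a list.\<close>

lemma primitiveD:
  assumes "primitive u" "u \<noteq> []" "k < int (length u)" "int_walk (int (length u)) k h"
    and "\<And>i. 1 \<le> i \<Longrightarrow> i \<le> int (length u) \<Longrightarrow> letter u (nat i) = v (h i)"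
  shows False
proof -
  let ?n = "length u"
  have range: "1 \<le> h (int i) \<and> h (int i) \<le> k" if "1 \<le> i" "i \<le> ?n" for i
    using int_walk_range[OF assms(4), of "int i"] that by auto
  let ?v = "map (\<lambda>j. v (int j)) [1..<Suc (nat k)]" and ?h = "\<lambda>i. nat (h (int i))"
  have k: "1 \<le> k" using range[of 1] assms(2) by (cases u) auto
  have letter_v: "letter ?v j = v (int j)" if "1 \<le> j" "j \<le> nat k" for j
    using that nth_upt[of 1 "j - 1" "Suc (nat k)"] by (simp add: letter_def del: upt_Suc)
  have "walk ?n (nat k) ?h"
    unfolding walk_def
  proof
    show "?h ` {1..?n} = {1..nat k}"
    proof (intro equalityI subsetI)
      fix x assume "x \<in> ?h ` {1..?n}"
      then obtain i where "i \<in> {1..?n}" "x = ?h i" by blast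
      then show "x \<in> {1..nat k}" using range[of i] by auto
    next
      fix x assume "x \<in> {1..nat k}"
      then have "int x \<in> h ` {1..int ?n}" using assms(4) k by (auto simp: int_walk_def)
      then obtain i where "1 \<le> i" "i \<le> int ?n" "int x = h i" by auto
      then show "x \<in> ?h ` {1..?n}" by (intro image_eqI[of _ _ "nat i"]) auto
    qed
    show "\<forall>i. 1 \<le> i \<and> i < ?n \<longrightarrow> \<bar>int (?h (i + 1)) - int (?h i)\<bar> \<le> 1"
    proof (intro allI impI)
      fix i assume i: "1 \<le> i \<and> i < ?n"
      then have "\<bar>h (int i + 1) - h (int i)\<bar> \<le> 1" using assms(4) by (auto simp: int_walk_def)
      then show "\<bar>int (?h (i + 1)) - int (?h i)\<bar> \<le> 1"
        using range[of i] range[of "i + 1"] i by (simp add: add.commute)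
    qed
  qed
  moreover have "u = word_along ?v ?n ?h"
  proof (rule nth_equalityI)
    fix i assume i: "i < length u"
    have "word_along ?v ?n ?h ! i = letter ?v (?h (Suc i))"
      using i by (simp add: word_along_def nth_map_upt del: upt_Suc)
    also have "\<dots> = v (h (int (Suc i)))"
      using letter_v[of "?h (Suc i)"] range[of "Suc i"] i by auto
    also have "\<dots> = u ! i" using assms(5)[of "int (Suc i)"] i by (simp add: letter_def nat_add_distrib)
    finally show "u ! i = word_along ?v ?n ?h ! i" by simp
  qed (simp add: word_along_def del: upt_Suc)
  ultimately have "generates ?v u" unfolding generates_def
    by (intro exI[of _ ?n] exI[of _ ?h]) (simp del: upt_Suc)
  moreover have "length ?v < length u" using assms(3) k by (simp add: nat_less_iff del: upt_Suc)
  ultimately show False using assms(1) unfolding primitive_def by blast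
qed

text \<open>Two equal neighbours could be merged: a walk that pauses at \<open>i\<close> restores
  the word.\<close>

lemma primitive_no_repeat:
  assumes prim: "primitive u" and i: "1 \<le> i" "i < int (length u)"
  shows "letter u (nat i) \<noteq> letter u (nat (i + 1))"
proof
  assume eq: "letter u (nat i) = letter u (nat (i + 1))"
  have u: "u \<noteq> []" using i by auto
  let ?n = "int (length u)"
  show False
  proof (rule primitiveD[OF prim u, of "?n - 1" "\<lambda>j. if j \<le> i then j else j - 1"
        "\<lambda>j. letter u (nat (if j \<le> i then j else j + 1))"])
    show "int_walk ?n (?n - 1) (\<lambda>j. if j \<le> i then j else j - 1)"
    proof (rule int_walkI)
      show "1 \<in> (\<lambda>j. if j \<le> i then j else j - 1) ` {1..?n}"
        using i by (intro image_eqI[of _ _ 1]) auto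
      show "?n - 1 \<in> (\<lambda>j. if j \<le> i then j else j - 1) ` {1..?n}"
        using i by (intro image_eqI[of _ _ ?n]) auto
    qed (use i in auto)
    fix j assume "1 \<le> j" "j \<le> ?n"
    consider "j \<le> i" | "j = i + 1" | "i + 1 < j" by linarith
    then show "letter u (nat j) =
        letter u (nat (if (if j \<le> i then j else j - 1) \<le> i then if j \<le> i then j else j - 1
          else (if j \<le> i then j else j - 1) + 1))"
      by cases (use eq in auto)
  qed simp
qed

text \<open>From each kind of fold all but one copy of \<open>x\<close> can be removed; walking to
  and fro over the remaining copy regenerates \<open>u\<close>.\<close>

lemma primitive_no_fold:
  assumes prim: "primitive u" and L: "1 \<le> L"
  shows "\<not> fold_at (int (length u)) (\<lambda>i. letter u (nat i)) L"
proof
  let ?n = "int (length u)" and ?U = "\<lambda>i. letter u (nat i)"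
  assume "fold_at ?n ?U L"
  then obtain p where p: "1 \<le> p - L" "p + L \<le> ?n" "pal_at ?U p L"
    and *: "p - L = 1 \<or> p + L = ?n \<or> p + 2 * L \<le> ?n \<and> pal_at ?U (p + L) L"
    unfolding fold_at_def by blast
  have u: "u \<noteq> []" using p L by auto
  from * consider "p - L = 1" | "p + L = ?n" | "p + 2 * L \<le> ?n" "pal_at ?U (p + L) L" by blast
  then show False
  proof cases
    case 1
    \<comment> \<open>The generator is the suffix of \<open>u\<close> from position
      \<open>p = L + 1\<close> on; the walk descends to its first letter and then runs
      forward.\<close>
    let ?h = "\<lambda>j. 1 + \<bar>j - p\<bar>"
    show False
    proof (rule primitiveD[OF prim u, of "?n - L" ?h "\<lambda>j. ?U (j + L)"])
      show "int_walk ?n (?n - L) ?h"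
      proof (rule int_walkI)
        show "1 \<in> ?h ` {1..?n}" using 1 p L by (intro image_eqI[of _ _ p]) auto
        show "?n - L \<in> ?h ` {1..?n}" using 1 p L by (intro image_eqI[of _ _ ?n]) auto
      qed (use 1 p L in auto)
      fix j assume j: "1 \<le> j" "j \<le> ?n"
      show "?U j = ?U (?h j + L)"
      proof (cases "p \<le> j")
        case True
        then have "?h j + L = j" using 1 by simp
        then show ?thesis by (simp only:)
      next
        case False
        then have "?h j + L = 2 * p - j" using 1 by simp
        moreover have "?U (2 * p - j) = ?U j" by (rule pal_at_reflect[OF p(3)]) (use False 1 j in simp)
        ultimately show ?thesis by (simp only:)
      qed
    qed (use L in simp)
  next
    case 2
    \<comment> \<open>The generator is the prefix of length \<open>p\<close>, and the walk turns
      back at \<open>p\<close>.\<close>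
    let ?h = "\<lambda>j. p - \<bar>j - p\<bar>"
    show False
    proof (rule primitiveD[OF prim u, of "?n - L" ?h ?U])
      show "int_walk ?n (?n - L) ?h"
      proof (rule int_walkI)
        show "1 \<in> ?h ` {1..?n}" using 2 p L by (intro image_eqI[of _ _ 1]) auto
        show "?n - L \<in> ?h ` {1..?n}" using 2 p L by (intro image_eqI[of _ _ p]) auto
      qed (use 2 p L in auto)
      fix j assume j: "1 \<le> j" "j \<le> ?n"
      show "?U j = ?U (?h j)"
      proof (cases "j \<le> p")
        case False
        then show ?thesis using pal_at_reflect[OF p(3), of j] 2 j by (simp add: algebra_simps)
      qed simp
    qed (use L in simp)
  next
    case 3
    \<comment> \<open>Positions \<open>p + 1\<close> to \<open>p + 2 * L\<close> are removed; the
      walk goes to \<open>p\<close>, back to \<open>p - L\<close> and forward again.\<close>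
    let ?h = "\<lambda>j. if j \<le> p then j else if j \<le> p + L then 2 * p - j else j - 2 * L"
    show False
    proof (rule primitiveD[OF prim u, of "?n - 2 * L" ?h "\<lambda>j. ?U (if j \<le> p then j else j + 2 * L)"])
      show "int_walk ?n (?n - 2 * L) ?h"
      proof (rule int_walkI)
        show "1 \<in> ?h ` {1..?n}" using 3 p L by (intro image_eqI[of _ _ 1]) auto
        show "?n - 2 * L \<in> ?h ` {1..?n}" using 3 p L by (intro image_eqI[of _ _ ?n]) auto
      qed (use 3 p L in auto)
      fix j assume j: "1 \<le> j" "j \<le> ?n"
      consider "j \<le> p" | "p < j" "j \<le> p + L" | "p + L < j" "j \<le> p + 2 * L" | "p + 2 * L < j"
        by linarith
      then show "?U j = ?U (if ?h j \<le> p then ?h j else ?h j + 2 * L)"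
      proof cases
        case 2
        then show ?thesis using pal_at_reflect[OF p(3), of j] by simp
      next
        case 3
        \<comment> \<open>On the third passage, the reflections at \<open>p + L\<close> and then at
          \<open>p\<close> lead back by \<open>2 * L\<close>.\<close>
        have "2 * p - (2 * (p + L) - j) = j - 2 * L" by simp
        then have "?U (j - 2 * L) = ?U j"
          using pal_at_reflect[OF \<open>pal_at ?U (p + L) L\<close>, of j]
            pal_at_reflect[OF p(3), of "2 * (p + L) - j"] 3 by simp
        then show ?thesis using 3 L by simp
      qed (use L in auto)
    qed (use L in simp)
  qed
qed

section \<open>Defects and the equivalence they generate\<close>

lemma defectI:
  assumes "1 \<le> a" "a < b" "b \<le> length u"
    and pal: "\<And>j. a \<le> j \<Longrightarrow> j \<le> b \<Longrightarrow> letter u (a + b - j) = letter u j"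
  shows "(a, b) \<in> defects u"
proof -
  have len: "length (factor u a b) = Suc b - a" by (simp add: factor_def del: upt_Suc)
  have nth: "factor u a b ! i = letter u (a + i)" if "i < Suc b - a" for i
    using that by (simp add: factor_def nth_map_upt del: upt_Suc)
  have "rev (factor u a b) = factor u a b"
  proof (rule nth_equalityI)
    fix i assume "i < length (rev (factor u a b))"
    then have i: "i < Suc b - a" by (simp add: len)
    have "rev (factor u a b) ! i = factor u a b ! (Suc b - a - Suc i)"
      using i by (simp add: rev_nth len)
    also have "\<dots> = letter u (a + (Suc b - a - Suc i))" using i by (intro nth) auto
    also have "a + (Suc b - a - Suc i) = a + b - (a + i)" using i assms by auto
    also have "letter u \<dots> = factor u a b ! i" using pal[of "a + i"] nth[OF i] i by simp
    finally show "rev (factor u a b) ! i = factor u a b ! i" .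
  qed simp
  then show ?thesis using assms by (simp add: defects_def nontrivial_palindrome_def len)
qed

lemma defect_letter:
  assumes "(a, b) \<in> defects u"
  shows "letter u a = letter u b"
proof -
  have ab: "1 \<le> a" "a \<le> b" and rv: "rev (factor u a b) = factor u a b"
    using assms by (auto simp: defects_def nontrivial_palindrome_def)
  have ne: "factor u a b \<noteq> []" using ab by (simp add: factor_def)
  have "hd (factor u a b) = letter u a" using ab by (simp add: factor_def hd_map upt_rec)
  moreover have "last (factor u a b) = letter u b" using ab by (simp add: factor_def)
  ultimately show ?thesis using rv ne by (metis hd_rev)
qed

text \<open>Carrying the same letter is an equivalence on positions that contains all defects, hence
  contains the smallest such equivalence.\<close>

lemma defect_equiv_letter:
  assumes "(a, b) \<in> defect_equiv u"
  shows "letter u a = letter u b"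
proof -
  let ?R = "{(i, j). i \<in> {1..length u} \<and> j \<in> {1..length u} \<and> letter u i = letter u j}"
  have "equiv {1..length u} ?R"
    by (rule equivI) (auto simp: refl_on_def sym_def trans_def)
  moreover have "defects u \<subseteq> ?R" using defects_subset[of u] defect_letter by fastforce
  ultimately have "(a, b) \<in> ?R" using assms unfolding defect_equiv_def by blast
  then show ?thesis by simp
qed

section \<open>Transfer between natural and integer positions\<close>

lemma word_along_eq_iff:
  "word_along u m f = word_along u m g \<longleftrightarrow> (\<forall>i\<in>{1..m}. letter u (f i) = letter u (g i))"
  by (auto simp: word_along_def simp del: upt_Suc)

lemma walk_int_walk:
  assumes "walk m n f"
  shows "int_walk (int m) (int n) (\<lambda>i. int (f (nat i)))"
proof -
  have "(\<lambda>i. int (f (nat i))) ` {1..int m} = {1..int n}"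
  proof (intro equalityI subsetI)
    fix v assume "v \<in> (\<lambda>i. int (f (nat i))) ` {1..int m}"
    then obtain i where i: "i \<in> {1..int m}" "v = int (f (nat i))" by blast
    then have "f (nat i) \<in> f ` {1..m}" by (intro imageI) auto
    then show "v \<in> {1..int n}" using assms i by (auto simp: walk_def)
  next
    fix v assume v: "v \<in> {1..int n}"
    then have "nat v \<in> f ` {1..m}" using assms by (auto simp: walk_def)
    then obtain i where "i \<in> {1..m}" "nat v = f i" by blast
    then show "v \<in> (\<lambda>i. int (f (nat i))) ` {1..int m}"
      using v by (intro image_eqI[of _ _ "int i"]) auto
  qed
  moreover have "\<bar>int (f (nat (i + 1))) - int (f (nat i))\<bar> \<le> 1" if "1 \<le> i" "i < int m" for i
  proof -
    have "nat (i + 1) = nat i + 1" using that by simp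
    moreover have "1 \<le> nat i" "nat i < m" using that by auto
    ultimately show ?thesis using assms unfolding walk_def by metis
  qed
  ultimately show ?thesis by (simp add: int_walk_def)
qed

text \<open>The disjunct \<open>a = b\<close> provides reflexivity on all integers, as the locale
  requires; \<open>defect_equiv\<close> is reflexive only on the positions of
  \<open>u\<close>.\<close>

lemma primitive_irreducible_word:
  assumes "primitive u"
  shows "irreducible_word (\<lambda>i. letter u (nat i)) (int (length u))
    (\<lambda>a b. a = b \<or> (nat a, nat b) \<in> defect_equiv u)"
proof
  fix a b :: int
  assume ab: "1 \<le> a" "a < b" "b \<le> int (length u)"
    and pal: "\<forall>j\<in>{a..b}. letter u (nat (a + b - j)) = letter u (nat j)"
  have "(nat a, nat b) \<in> defects u"
  proof (rule defectI)
    fix j assume j: "nat a \<le> j" "j \<le> nat b"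
    have "nat (a + b - int j) = nat a + nat b - j" using ab j by auto
    then show "letter u (nat a + nat b - j) = letter u j"
      using bspec[OF pal, of "int j"] ab j by (simp add: le_nat_iff nat_le_iff)
  qed (use ab in auto)
  then show "a = b \<or> (nat a, nat b) \<in> defect_equiv u" using defects_subset_defect_equiv by blast
next
  show "a = b \<or> (nat a, nat b) \<in> defect_equiv u \<Longrightarrow> b = a \<or> (nat b, nat a) \<in> defect_equiv u"
    for a b :: int
    using equiv_defect_equiv[of u] by (auto simp: equiv_def dest: symD)
  show "a = b \<or> (nat a, nat b) \<in> defect_equiv u \<Longrightarrow> b = c \<or> (nat b, nat c) \<in> defect_equiv u
      \<Longrightarrow> a = c \<or> (nat a, nat c) \<in> defect_equiv u" for a b c :: int
    using equiv_defect_equiv[of u] by (auto simp: equiv_def dest: transD)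
qed (use primitive_no_repeat[OF assms] primitive_no_fold[OF assms] in auto)

theorem theorem3:
  fixes u :: "'a list" and f g :: "nat \<Rightarrow> nat" and m n :: nat
  assumes "primitive u" and "length u = n"
    and "walk m n f" and "walk m n g"
  shows "word_along u m f = word_along u m g \<longleftrightarrow>
           (\<forall>i\<in>{1..m}. (f i, g i) \<in> defect_equiv u)"
proof
  assume "\<forall>i\<in>{1..m}. (f i, g i) \<in> defect_equiv u"
  then show "word_along u m f = word_along u m g"
    unfolding word_along_eq_iff using defect_equiv_letter by blast
next
  assume "word_along u m f = word_along u m g"
  then have eq: "letter u (f i) = letter u (g i)" if "i \<in> {1..m}" for i
    using that by (simp add: word_along_eq_iff)
  interpret irreducible_word "\<lambda>i. letter u (nat i)" "int n"
    "\<lambda>a b. a = b \<or> (nat a, nat b) \<in> defect_equiv u"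
    using primitive_irreducible_word[OF assms(1)] assms(2) by simp
  show "\<forall>i\<in>{1..m}. (f i, g i) \<in> defect_equiv u"
  proof
    fix i assume i: "i \<in> {1..m}"
    have "int (f (nat (int i))) = int (g (nat (int i))) \<or>
        (nat (int (f (nat (int i)))), nat (int (g (nat (int i))))) \<in> defect_equiv u"
      by (rule walks_relatedD[OF all_walks_related walk_int_walk[OF assms(3)] walk_int_walk[OF assms(4)]])
        (use eq i in \<open>auto simp: nat_le_iff le_nat_iff\<close>)
    then have "f i = g i \<or> (f i, g i) \<in> defect_equiv u" by simp
    \<comment> \<open>The values of a walk are positions of \<open>u\<close>, so the case
      \<open>f i = g i\<close> is absorbed by reflexivity.\<close>
    moreover have "f i \<in> {1..length u}" using assms(2,3) i by (auto simp: walk_def)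
    then have "(f i, f i) \<in> defect_equiv u"
      using equiv_defect_equiv[of u] by (auto simp: equiv_def refl_on_def)
    ultimately show "(f i, g i) \<in> defect_equiv u" by auto
  qed
qed

end
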